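(* Let $G$ be a digraph with transitive closure $\bar G$, and $f$ a discrete Morse function on $G$. Let $\bar f$ be the extension of $f$ to $\bar G$, assumed to be a discrete Morse function on $\bar G$, and let $\overline{V}=\mathrm{grad}\,\bar f$ be the discrete gradient vector field on $\bar G$. Suppose $\Omega_*(G)$ is $\overline{V}$-invariant, i.e. $\overline{V}(\Omega_n(G))\subseteq\Omega_{n+1}(G)$ for all $n\ge 0$. For $n\ge 0$ let $A_n\subseteq P_n(\bar G)$ be the real span of the elements $\alpha+\overline{V}\partial(\alpha)$ with $\alpha$ ranging over the critical $n$-paths of $\bar f$ on $\bar G$. Then for every $m\ge 0$, $$H_m(G;\mathbb{R})\cong H_m\big(\{A_n\cap\Omega_n(G),\partial_n\}_{n\ge 0}\big).$$
   Context: A digraph $G$ consists of a finite vertex set $V$ and a non-empty edge set $E\subseteq V\times V\setminus\mathrm{diag}$; $(u,v)\in E$ is written $u\to v$. A digraph is transitive if for any two edges $u\to v$ and $v\to w$ there is an edge $u\to w$. The transitive closure $\bar G$ of $G$ is the smallest transitive digraph containing $G$; it has the same vertex set as $G$, and the extension $\bar f$ of $f$ satisfies $\bar f(v)=f(v)$ for all vertices $v$. $\Lambda_n(V)$ is the real vector space with basis all sequences $v_0\cdots v_n$ of vertices (elementary $n$-paths), with inner product $\langle\cdot,\cdot\rangle$ making elementary paths orthonormal. $\partial=\partial_n:\Lambda_n(V)\to\Lambda_{n-1}(V)$ is $\partial(v_0\cdots v_n)=\sum_{i=0}^n(-1)^i v_0\cdots\widehat{v_i}\cdots v_n$ (with $\partial_0=0$).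 For a digraph $G$, an allowed elementary $n$-path on $G$ is $v_0\cdots v_n$ with $v_{i-1}\to v_i$ an edge for $1\le i\le n$; $P_n(G)$ is their span, $\Omega_n(G)=\{x\in P_n(G):\partial x\in P_{n-1}(G)\}$, and the path homology is $H_m(G;\mathbb{R})=H_m(\{\Omega_n(G),\partial_n\}_{n\ge0})$. For allowed elementary paths, $\alpha>\beta$ (or $\beta<\alpha$) means $\beta$ is obtained from $\alpha$ by removing some vertices; a superscript $(n)$ indicates an $n$-path. For $f:V\to[0,+\infty)$ put $f(v_0\cdots v_n)=\sum_i f(v_i)$. $f$ is a discrete Morse function on a digraph if for every allowed elementary $\alpha^{(n)}$ on it, $\#\{\gamma^{(n+1)}>\alpha \mid f(\gamma)=f(\alpha)\}\le1$ and $\#\{\beta^{(n-1)}<\alpha \mid f(\beta)=f(\alpha)\}\le1$, with $\gamma,\beta$ allowed elementary paths on that digraph; $\alpha^{(n)}$ is critical if both numbers are $0$. $\overline{V}=\mathrm{grad}\bar f:P_n(\bar G)\to P_{n+1}(\bar G)$ is the linear map with $\overline{V}(\alpha)=-\langle\partial\gamma,\alpha\rangle\gamma$ if there is an allowed elementary $\gamma^{(n+1)}>\alpha^{(n)}$ on $\bar G$ with $\bar f(\gamma)=\bar f(\alpha)$, and $\overline{V}(\alpha)=0$ otherwise. *)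

theory Defs
  imports
    "HOL-Analysis.Finite_Function_Topology"
    "HOL-Library.Sublist"
    "HOL-Library.Set_Algebras"
begin

section \<open>Digraphs and their transitive closure\<close>

definition digraph :: "'a set \<Rightarrow> ('a \<times> 'a) set \<Rightarrow> bool" where
  "digraph V E \<longleftrightarrow> finite V \<and> E \<noteq> {} \<and> E \<subseteq> V \<times> V - Id"

text \<open>Since digraphs have no loops, transitivity applied to \<open>u \<rightarrow> v \<rightarrow> u\<close> shows that a transitive
  digraph has no directed cycles. Hence the closure below exists exactly for acyclic digraphs, where
  it is the usual transitive closure of the edge relation; see \<open>transitive_closure_of_iff\<close>.\<close>

definition transitive_closure_of :: "'a set \<Rightarrow> ('a \<times> 'a) set \<Rightarrow> ('a \<times> 'a) set \<Rightarrow> bool" where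
  "transitive_closure_of V E F \<longleftrightarrow>
     digraph V F \<and> trans F \<and> E \<subseteq> F \<and>
     (\<forall>W F'. digraph W F' \<and> trans F' \<and> V \<subseteq> W \<and> E \<subseteq> F' \<longrightarrow> F \<subseteq> F')"

lemma transitive_closure_of_iff:
  assumes "digraph V E"
  shows "transitive_closure_of V E F \<longleftrightarrow> acyclic E \<and> F = E\<^sup>+"
proof
  have EV: "E \<subseteq> V \<times> V" and fin: "finite V" and ne: "E\<^sup>+ \<noteq> {}"
    using assms unfolding digraph_def by auto
  note sigma = trancl_subset_Sigma[OF EV]
  {
    assume "transitive_closure_of V E F"
    then have F: "digraph V F" "trans F" "E \<subseteq> F"
      and least: "\<And>W F'. digraph W F' \<Longrightarrow> trans F' \<Longrightarrow> V \<subseteq> W \<Longrightarrow> E \<subseteq> F' \<Longrightarrow> F \<subseteq> F'"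
      unfolding transitive_closure_of_def by blast+
    have sub: "E\<^sup>+ \<subseteq> F"
      using trancl_mono_subset[OF F(3)] trancl_id[OF F(2)] by simp
    have irr: "E\<^sup>+ \<inter> Id = {}"
      using F(1) sub unfolding digraph_def by blast
    have "digraph V (E\<^sup>+)"
      unfolding digraph_def using fin ne sigma irr by blast
    from least[OF this trans_trancl order_refl trancl_incr] sub have "F = E\<^sup>+"
      by (rule equalityI)
    with irr show "acyclic E \<and> F = E\<^sup>+"
      unfolding acyclic_def by blast
  }
  assume F: "acyclic E \<and> F = E\<^sup>+"
  have "digraph V (E\<^sup>+)"
    unfolding digraph_def using F fin ne sigma unfolding acyclic_def by blast
  moreover have "E\<^sup>+ \<subseteq> F'" if "trans F'" "E \<subseteq> F'" for F'
    using trancl_mono_subset[OF that(2)] trancl_id[OF that(1)] by simp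
  ultimately show "transitive_closure_of V E F"
    using F trans_trancl[of E] trancl_incr[of E] unfolding transitive_closure_of_def by simp
qed


section \<open>Paths, chains and path homology\<close>

text \<open>The elementary \<open>n\<close>-path \<open>v\<^sub>0\<cdots>v\<^sub>n\<close> is the list \<open>[v\<^sub>0, \<dots>, v\<^sub>n]\<close> of length \<open>n + 1\<close>. All the spaces
  \<open>\<Lambda>\<^sub>n(V)\<close> live as graded pieces in the free real vector space on lists.\<close>

type_synonym 'a chain = "'a list \<Rightarrow>\<^sub>0 real"

abbreviation elem :: "'a list \<Rightarrow> 'a chain" where
  "elem p \<equiv> Poly_Mapping.single p 1"

definition lin_ext :: "('a list \<Rightarrow> 'b::real_vector) \<Rightarrow> 'a chain \<Rightarrow> 'b" where
  "lin_ext g x = (\<Sum>p\<in>Poly_Mapping.keys x. Poly_Mapping.lookup x p *\<^sub>R g p)"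

lemma lin_ext_elem [simp]: "lin_ext g (elem p) = g p"
  by (simp add: lin_ext_def)

lemma lin_ext_superset:
  assumes "finite S" "Poly_Mapping.keys x \<subseteq> S"
  shows "lin_ext g x = (\<Sum>p\<in>S. Poly_Mapping.lookup x p *\<^sub>R g p)"
  unfolding lin_ext_def using assms
  by (intro sum.mono_neutral_left) (auto simp: in_keys_iff)

lemma linear_lin_ext: "linear (lin_ext g)"
proof (rule linearI)
  fix x y :: "'a chain" and c :: real
  let ?S = "Poly_Mapping.keys x \<union> Poly_Mapping.keys y"
  have "lin_ext g (x + y) = (\<Sum>p\<in>?S. Poly_Mapping.lookup (x + y) p *\<^sub>R g p)"
    by (intro lin_ext_superset) (auto dest: subsetD[OF Poly_Mapping.keys_add])
  also have "\<dots> = lin_ext g x + lin_ext g y"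
    by (simp add: lin_ext_superset[of ?S x] lin_ext_superset[of ?S y] lookup_add
        scaleR_left_distrib sum.distrib)
  finally show "lin_ext g (x + y) = lin_ext g x + lin_ext g y" .
  have lk: "Poly_Mapping.lookup (c *\<^sub>R x) p = c * Poly_Mapping.lookup x p" for p
    by (simp add: scaleR_poly_mapping_def Abs_poly_mapping_inverse)
  have "lin_ext g (c *\<^sub>R x) =
      (\<Sum>p\<in>Poly_Mapping.keys x. Poly_Mapping.lookup (c *\<^sub>R x) p *\<^sub>R g p)"
    by (intro lin_ext_superset) (auto simp: in_keys_iff lk)
  then show "lin_ext g (c *\<^sub>R x) = c *\<^sub>R lin_ext g x"
    by (simp add: lin_ext_def lk scaleR_sum_right)
qed

definition chain_inner :: "'a chain \<Rightarrow> 'a chain \<Rightarrow> real" where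
  "chain_inner x y =
     (\<Sum>p\<in>Poly_Mapping.keys x. Poly_Mapping.lookup x p * Poly_Mapping.lookup y p)"

definition remove_nth :: "nat \<Rightarrow> 'a list \<Rightarrow> 'a list" where
  "remove_nth i p = take i p @ drop (Suc i) p"

text \<open>All the maps \<open>\<partial>\<^sub>n\<close> at once; \<open>\<partial>\<^sub>0 = 0\<close> is the first branch.\<close>

definition path_boundary :: "'a chain \<Rightarrow> 'a chain" where
  "path_boundary = lin_ext (\<lambda>p. if length p \<le> 1 then 0
     else (\<Sum>i<length p. (-1) ^ i *\<^sub>R elem (remove_nth i p)))"

definition allowed :: "'a set \<Rightarrow> ('a \<times> 'a) set \<Rightarrow> 'a list \<Rightarrow> bool" where
  "allowed V E p \<longleftrightarrow> p \<noteq> [] \<and> set p \<subseteq> V \<and> successively (\<lambda>u v. (u, v) \<in> E) p"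

definition allowed_chains :: "'a set \<Rightarrow> ('a \<times> 'a) set \<Rightarrow> nat \<Rightarrow> 'a chain set" where
  "allowed_chains V E n = span (elem ` {p. allowed V E p \<and> length p = Suc n})"

text \<open>The condition on the boundary is void for \<open>n = 0\<close>, as \<open>\<partial>\<^sub>0 = 0\<close>.\<close>

definition Omega :: "'a set \<Rightarrow> ('a \<times> 'a) set \<Rightarrow> nat \<Rightarrow> 'a chain set" where
  "Omega V E n = {x \<in> allowed_chains V E n. n > 0 \<longrightarrow> path_boundary x \<in> allowed_chains V E (n - 1)}"


section \<open>Homology of chain complexes of subspaces\<close>

definition chain_complex :: "(nat \<Rightarrow> 'v::real_vector set) \<Rightarrow> ('v \<Rightarrow> 'v) \<Rightarrow> bool" where
  "chain_complex C d \<longleftrightarrow>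
     linear d \<and> (\<forall>n. subspace (C n)) \<and> (\<forall>x\<in>C 0. d x = 0) \<and>
     (\<forall>n. \<forall>x\<in>C (Suc n). d x \<in> C n \<and> d (d x) = 0)"

definition cycle_space :: "(nat \<Rightarrow> 'v::real_vector set) \<Rightarrow> ('v \<Rightarrow> 'v) \<Rightarrow> nat \<Rightarrow> 'v set" where
  "cycle_space C d m = {x \<in> C m. d x = 0}"

definition boundary_space :: "(nat \<Rightarrow> 'v::real_vector set) \<Rightarrow> ('v \<Rightarrow> 'v) \<Rightarrow> nat \<Rightarrow> 'v set" where
  "boundary_space C d m = d ` C (Suc m)"

text \<open>A quotient \<open>Z/B\<close> of real vector spaces is the set of cosets \<open>z +o B\<close>; addition of cosets is
  addition of sets from \<^theory>\<open>HOL-Library.Set_Algebras\<close>. In the scalar multiplication, adding \<open>B\<close>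
  matters only for the scalar 0.\<close>

definition quot_space :: "'v::real_vector set \<Rightarrow> 'v set \<Rightarrow> 'v set set" where
  "quot_space Z B = (\<lambda>z. z +o B) ` Z"

definition quot_scale :: "'v::real_vector set \<Rightarrow> real \<Rightarrow> 'v set \<Rightarrow> 'v set" where
  "quot_scale B c X = (*\<^sub>R) c ` X + B"

lemma quot_add_coset:
  assumes "subspace B"
  shows "(x +o B) + (y +o B) = (x + y) +o B"
proof -
  have "B + B = B"
  proof
    show "B + B \<subseteq> B"
      using assms by (auto simp: set_plus_def subspace_add)
    show "B \<subseteq> B + B"
    proof
      fix b assume "b \<in> B"
      then have "0 + b \<in> B + B"
        using assms subspace_0 by blast
      then show "b \<in> B + B" by simp
    qed
  qed
  then show ?thesis
    by (metis set_plus_rearrange)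
qed

lemma quot_scale_coset:
  assumes "subspace B"
  shows "quot_scale B c (x +o B) = (c *\<^sub>R x) +o B"
proof
  show "quot_scale B c (x +o B) \<subseteq> (c *\<^sub>R x) +o B"
    using assms
    by (auto simp: quot_scale_def elt_set_plus_def set_plus_def scaleR_right_distrib add.assoc
        subspace_add subspace_scale)
  show "(c *\<^sub>R x) +o B \<subseteq> quot_scale B c (x +o B)"
  proof
    fix y assume "y \<in> (c *\<^sub>R x) +o B"
    then obtain b where b: "b \<in> B" "y = c *\<^sub>R x + b"
      by (auto simp: elt_set_plus_def)
    have "x \<in> x +o B"
      using assms by (force simp: elt_set_plus_def subspace_0)
    with b show "y \<in> quot_scale B c (x +o B)"
      by (auto simp: quot_scale_def)
  qed
qed

definition homology :: "(nat \<Rightarrow> 'v::real_vector set) \<Rightarrow> ('v \<Rightarrow> 'v) \<Rightarrow> nat \<Rightarrow> 'v set set" where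
  "homology C d m = quot_space (cycle_space C d m) (boundary_space C d m)"

text \<open>Isomorphism of the real vector spaces \<open>H\<^sub>m(C, d)\<close> and \<open>H\<^sub>m(C', d')\<close>.\<close>

definition homology_isomorphic ::
  "(nat \<Rightarrow> 'v::real_vector set) \<Rightarrow> ('v \<Rightarrow> 'v) \<Rightarrow>
   (nat \<Rightarrow> 'w::real_vector set) \<Rightarrow> ('w \<Rightarrow> 'w) \<Rightarrow> nat \<Rightarrow> bool" where
  "homology_isomorphic C d C' d' m \<longleftrightarrow>
     (\<exists>\<phi>. bij_betw \<phi> (homology C d m) (homology C' d' m) \<and>
          (\<forall>X\<in>homology C d m. \<forall>Y\<in>homology C d m. \<phi> (X + Y) = \<phi> X + \<phi> Y) \<and>
          (\<forall>c. \<forall>X\<in>homology C d m.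
             \<phi> (quot_scale (boundary_space C d m) c X) =
             quot_scale (boundary_space C' d' m) c (\<phi> X)))"


section \<open>Discrete Morse functions and the gradient vector field\<close>

definition path_value :: "('a \<Rightarrow> real) \<Rightarrow> 'a list \<Rightarrow> real" where
  "path_value f p = sum_list (map f p)"

text \<open>The relation \<open>\<beta> < \<alpha>\<close> between paths is \<^const>\<open>strict_subseq\<close>. As the empty list is not allowed,
  the set \<open>equal_faces\<close> of a 0-path is empty.\<close>

definition equal_cofaces ::
  "'a set \<Rightarrow> ('a \<times> 'a) set \<Rightarrow> ('a \<Rightarrow> real) \<Rightarrow> 'a list \<Rightarrow> 'a list set" where
  "equal_cofaces V E f \<alpha> =
     {\<gamma>. allowed V E \<gamma> \<and> length \<gamma> = Suc (length \<alpha>) \<and> strict_subseq \<alpha> \<gamma> \<and>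
         path_value f \<gamma> = path_value f \<alpha>}"

definition equal_faces ::
  "'a set \<Rightarrow> ('a \<times> 'a) set \<Rightarrow> ('a \<Rightarrow> real) \<Rightarrow> 'a list \<Rightarrow> 'a list set" where
  "equal_faces V E f \<alpha> =
     {\<beta>. allowed V E \<beta> \<and> Suc (length \<beta>) = length \<alpha> \<and> strict_subseq \<beta> \<alpha> \<and>
         path_value f \<beta> = path_value f \<alpha>}"

definition discrete_morse :: "'a set \<Rightarrow> ('a \<times> 'a) set \<Rightarrow> ('a \<Rightarrow> real) \<Rightarrow> bool" where
  "discrete_morse V E f \<longleftrightarrow>
     (\<forall>v\<in>V. 0 \<le> f v) \<and>
     (\<forall>\<alpha>. allowed V E \<alpha> \<longrightarrow>
        card (equal_cofaces V E f \<alpha>) \<le> 1 \<and> card (equal_faces V E f \<alpha>) \<le> 1)"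

text \<open>Both sets are finite if \<open>V\<close> is, so the cardinalities are the intended ones.\<close>

lemma finite_equal_cofaces: "finite V \<Longrightarrow> finite (equal_cofaces V E f \<alpha>)"
  by (rule finite_subset[OF _ finite_lists_length_eq[of V "Suc (length \<alpha>)"]])
    (auto simp: equal_cofaces_def allowed_def)

lemma finite_equal_faces: "finite V \<Longrightarrow> finite (equal_faces V E f \<alpha>)"
  by (rule finite_subset[OF _ finite_lists_length_eq[of V "length \<alpha> - 1"]])
    (auto simp: equal_faces_def allowed_def)

definition critical :: "'a set \<Rightarrow> ('a \<times> 'a) set \<Rightarrow> ('a \<Rightarrow> real) \<Rightarrow> 'a list \<Rightarrow> bool" where
  "critical V E f \<alpha> \<longleftrightarrow>
     allowed V E \<alpha> \<and> card (equal_cofaces V E f \<alpha>) = 0 \<and> card (equal_faces V E f \<alpha>) = 0"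

text \<open>The path \<open>\<gamma>\<close> is unique whenever \<open>f\<close> is a discrete Morse function and \<open>\<alpha>\<close> is allowed. Only the
  values on allowed chains are meaningful.\<close>

definition grad :: "'a set \<Rightarrow> ('a \<times> 'a) set \<Rightarrow> ('a \<Rightarrow> real) \<Rightarrow> 'a chain \<Rightarrow> 'a chain" where
  "grad V E f = lin_ext (\<lambda>\<alpha>.
     if equal_cofaces V E f \<alpha> = {} then 0
     else let \<gamma> = (THE \<gamma>. \<gamma> \<in> equal_cofaces V E f \<alpha>)
          in - chain_inner (path_boundary (elem \<gamma>)) (elem \<alpha>) *\<^sub>R elem \<gamma>)"

text \<open>The spaces \<open>A\<^sub>n\<close>, to be used with a transitive digraph.\<close>

definition critical_chains ::
  "'a set \<Rightarrow> ('a \<times> 'a) set \<Rightarrow> ('a \<Rightarrow> real) \<Rightarrow> nat \<Rightarrow> 'a chain set" where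
  "critical_chains V E f n =
     span {elem \<alpha> + grad V E f (path_boundary (elem \<alpha>)) | \<alpha>.
             critical V E f \<alpha> \<and> length \<alpha> = Suc n}"

end

theory Submission
  imports Defs
begin

text \<open>Equality \<open>f(\<gamma>) = f(\<alpha>)\<close> for a coface \<open>\<gamma>\<close> of \<open>\<alpha>\<close> means that the additional vertex of \<open>\<gamma>\<close> is a
  zero of \<open>f\<close>. On a transitive digraph all faces of an allowed path are allowed, so the Morse
  condition leaves at most one zero of \<open>f\<close> on every allowed path. Hence a path containing a zero has
  no coface of equal value, and exactly one face of equal value unless it is a 0-path. Writing \<open>V\<close>
  for the gradient, this gives \<open>V V = 0\<close> and \<open>V \<partial> V = -V\<close>. Therefore
  \<open>\<Phi> = 1 + \<partial> V + V \<partial>\<close>, which is chain homotopic to the identity, is already a projection onto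
  the subcomplex \<open>{x. V x = 0 \<and> V \<partial> x = 0}\<close>, without passing to the limit of its
  iterates. On any \<open>V\<close>-invariant subcomplex this subcomplex is cut out by the spaces \<open>A\<^sub>n\<close>.\<close>

section \<open>Homology of a deformation retract\<close>

lemma image_coset:
  assumes "linear h"
  shows "h ` (x +o B) = h x +o h ` B"
proof -
  have "h ` (\<lambda>b. x + b) ` B = (\<lambda>b. h x + b) ` h ` B"
    by (simp add: image_image linear_add[OF assms])
  then show ?thesis
    by (simp add: elt_set_plus_def image_def Bex_def)
qed

lemma coset_eq_iff:
  fixes x y :: "'v::real_vector"
  assumes "subspace B"
  shows "x +o B = y +o B \<longleftrightarrow> x - y \<in> B"
proof
  assume eq: "x +o B = y +o B"
  have "x \<in> x +o B"
    using assms by (force simp: elt_set_plus_def subspace_0)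
  then have "x \<in> y +o B"
    using eq by simp
  then obtain b where "b \<in> B" "x = y + b"
    by (auto simp: elt_set_plus_def)
  then show "x - y \<in> B" by simp
next
  assume d: "x - y \<in> B"
  have "\<exists>c\<in>B. x + b = y + c" if "b \<in> B" for b
    using subspace_add[OF assms d that] by (intro bexI[of _ "x - y + b"]) auto
  moreover have "\<exists>c\<in>B. y + b = x + c" if "b \<in> B" for b
    using subspace_diff[OF assms that d] by (intro bexI[of _ "b - (x - y)"]) auto
  ultimately show "x +o B = y +o B"
    by (auto simp: elt_set_plus_def)
qed

text \<open>Cosets are mapped by direct image under \<open>h\<close>, so no representatives are
  chosen: \<open>h\<close> sends the boundaries of \<open>C\<close> onto those of \<open>C'\<close>,
  hence cosets to cosets. Surjectivity comes from \<open>retract\<close>, injectivity from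
  \<open>homotopy\<close>.\<close>

lemma homology_isomorphic_deformation_retract:
  fixes C C' :: "nat \<Rightarrow> 'v::real_vector set"
  assumes C: "chain_complex C d" and C': "chain_complex C' d"
    and sub: "\<And>n. C' n \<subseteq> C n"
    and lin: "linear h"
    and into: "\<And>n x. x \<in> C n \<Longrightarrow> h x \<in> C' n"
    and retract: "\<And>n x. x \<in> C' n \<Longrightarrow> h x = x"
    and chain_map: "\<And>n x. x \<in> C n \<Longrightarrow> d (h x) = h (d x)"
    and homotopy: "\<And>n x. x \<in> C n \<Longrightarrow> d x = 0 \<Longrightarrow> h x - x \<in> d ` C (Suc n)"
  shows "homology_isomorphic C d C' d m"
proof -
  let ?Z = "cycle_space C d m" and ?B = "boundary_space C d m"
  let ?Z' = "cycle_space C' d m" and ?B' = "boundary_space C' d m"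
  have d: "linear d" and subC: "\<And>n. subspace (C n)" "\<And>n. subspace (C' n)"
    using C C' unfolding chain_complex_def by auto
  have B: "subspace ?B" and B': "subspace ?B'"
    unfolding boundary_space_def using d subC by (auto intro: linear_subspace_image)
  \<comment> \<open>\<open>h\<close> is onto in degree \<open>Suc m\<close> because it fixes
    \<open>C'\<close>; \<open>chain_map\<close> carries this over to the boundaries.\<close>
  have hB: "h ` ?B = ?B'"
  proof -
    have "h ` C (Suc m) = C' (Suc m)"
    proof
      show "h ` C (Suc m) \<subseteq> C' (Suc m)" using into by auto
      show "C' (Suc m) \<subseteq> h ` C (Suc m)"
      proof
        fix x assume "x \<in> C' (Suc m)"
        then show "x \<in> h ` C (Suc m)"
          using retract[of x] sub[of "Suc m"] by (metis imageI subsetD)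
      qed
    qed
    moreover have "h ` d ` C (Suc m) = d ` h ` C (Suc m)"
      unfolding image_image using chain_map by (intro image_cong) auto
    ultimately show ?thesis
      unfolding boundary_space_def by simp
  qed
  have B'B: "?B' \<subseteq> ?B"
    unfolding boundary_space_def using sub by auto
  have h_coset: "h ` (x +o ?B) = h x +o ?B'" for x
    using image_coset[OF lin] hB by simp
  have hZ: "h x \<in> ?Z'" if "x \<in> ?Z" for x
    using that into chain_map[of x m] linear_0[OF lin] unfolding cycle_space_def by auto
  have Z'Z: "?Z' \<subseteq> ?Z"
    unfolding cycle_space_def using sub by auto
  have subZ: "subspace ?Z"
    using subC d unfolding cycle_space_def subspace_def
    by (auto simp: linear_0 linear_add linear_scale)
  have "bij_betw ((`) h) (homology C d m) (homology C' d m)"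
    unfolding bij_betw_def
  proof
    show "inj_on ((`) h) (homology C d m)"
    proof (rule inj_onI)
      fix X Y assume "X \<in> homology C d m" "Y \<in> homology C d m" and eq: "h ` X = h ` Y"
      then obtain x y where x: "x \<in> ?Z" "X = x +o ?B" and y: "y \<in> ?Z" "Y = y +o ?B"
        unfolding homology_def quot_space_def by auto
      have "h x - h y \<in> ?B'"
        using eq x y h_coset coset_eq_iff[OF B'] by simp
      then have 1: "h (x - y) \<in> ?B"
        using B'B by (auto simp: linear_diff[OF lin])
      have "x - y \<in> ?Z"
        using subspace_diff[OF subZ] x y by blast
      then have "h (x - y) - (x - y) \<in> ?B"
        using homotopy[of "x - y" m] unfolding cycle_space_def boundary_space_def by blast
      with subspace_diff[OF B 1 this] have "x - y \<in> ?B" by simp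
      then show "X = Y"
        using x y coset_eq_iff[OF B] by simp
    qed
    show "(`) h ` homology C d m = homology C' d m"
    proof
      show "(`) h ` homology C d m \<subseteq> homology C' d m"
        unfolding homology_def quot_space_def using h_coset hZ by auto
      show "homology C' d m \<subseteq> (`) h ` homology C d m"
      proof
        fix Y assume "Y \<in> homology C' d m"
        then obtain y where y: "y \<in> ?Z'" "Y = y +o ?B'"
          unfolding homology_def quot_space_def by auto
        then have "Y = h ` (y +o ?B)"
          using h_coset[of y] retract[of y m] unfolding cycle_space_def by simp
        then show "Y \<in> (`) h ` homology C d m"
          unfolding homology_def quot_space_def using y Z'Z by auto
      qed
    qed
  qed
  moreover have "h ` (X + Y) = h ` X + h ` Y"
    if "X \<in> homology C d m" "Y \<in> homology C d m" for X Y
    using that unfolding homology_def quot_space_def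
    by (elim imageE) (simp add: quot_add_coset[OF B] quot_add_coset[OF B'] h_coset linear_add[OF lin])
  moreover have "h ` quot_scale ?B c X = quot_scale ?B' c (h ` X)"
    if "X \<in> homology C d m" for c X
    using that unfolding homology_def quot_space_def
    by (elim imageE)
      (simp add: quot_scale_coset[OF B] quot_scale_coset[OF B'] h_coset linear_scale[OF lin])
  ultimately show ?thesis
    unfolding homology_isomorphic_def by blast
qed

text \<open>Here \<open>g\<close> plays the role of the gradient \<open>V\<close>, and the retraction is \<open>\<Phi> = 1 + d g + g d\<close>.\<close>

lemma homology_isomorphic_gradient:
  fixes C :: "nat \<Rightarrow> 'v::real_vector set"
  assumes C: "chain_complex C d" and g: "linear g"
    and g_into: "\<And>n x. x \<in> C n \<Longrightarrow> g x \<in> C (Suc n)"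
    and gg: "\<And>n x. x \<in> C n \<Longrightarrow> g (g x) = 0"
    and gdg: "\<And>n x. x \<in> C n \<Longrightarrow> g (d (g x)) = - g x"
  defines "C' \<equiv> \<lambda>n. {x \<in> C n. g x = 0 \<and> g (d x) = 0}"
  shows "chain_complex C' d \<and> homology_isomorphic C d C' d m"
proof
  have d: "linear d" and subC: "\<And>n. subspace (C n)"
    and d0: "\<And>x. x \<in> C 0 \<Longrightarrow> d x = 0"
    and d_into: "\<And>n x. x \<in> C (Suc n) \<Longrightarrow> d x \<in> C n"
    and dd_Suc: "\<And>n x. x \<in> C (Suc n) \<Longrightarrow> d (d x) = 0"
    using C unfolding chain_complex_def by auto
  have dd: "d (d x) = 0" if "x \<in> C n" for n x
    using that dd_Suc d0 linear_0[OF d] by (cases n) auto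
  \<comment> \<open>The hypotheses on \<open>g\<close> are applied to \<open>d x\<close>, one degree
    lower. In degree 0 there is no lower degree, but there \<open>d x = 0\<close>.\<close>
  have gd: "g (g (d x)) = 0" "g (d (g (d x))) = - g (d x)" "g (d x) \<in> C n" if "x \<in> C n" for n x
  proof (atomize(full), cases n)
    case 0
    with that d0 have "d x = 0" by simp
    then show "g (g (d x)) = 0 \<and> g (d (g (d x))) = - g (d x) \<and> g (d x) \<in> C n"
      by (simp add: linear_0[OF d] linear_0[OF g] subspace_0[OF subC])
  next
    case (Suc k)
    with that d_into have "d x \<in> C k" by simp
    then show "g (g (d x)) = 0 \<and> g (d (g (d x))) = - g (d x) \<and> g (d x) \<in> C n"
      using gg gdg g_into Suc by blast
  qed
  let ?h = "\<lambda>x. x + d (g x) + g (d x)"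
  have h: "linear ?h"
    using d g by (intro linearI) (auto simp: linear_add linear_scale algebra_simps)
  have "subspace (C' n)" for n
    using subC[of n] d g unfolding C'_def subspace_def
    by (auto simp: linear_0 linear_add linear_scale)
  then show C': "chain_complex C' d"
    unfolding chain_complex_def using d d0 d_into dd dd_Suc linear_0[OF g]
    by (auto simp: C'_def)
  show "homology_isomorphic C d C' d m"
  proof (rule homology_isomorphic_deformation_retract[OF C C' _ h])
    show "C' n \<subseteq> C n" for n
      unfolding C'_def by auto
  next
    fix n x assume x: "x \<in> C n"
    have "?h x \<in> C n"
      using x g_into[OF x] d_into gd(3) by (intro subspace_add[OF subC]) auto
    \<comment> \<open>\<open>g (?h x) = g x - g x + 0\<close> by \<open>gdg\<close> and
      \<open>gd(1)\<close>, and \<open>g (d (?h x)) = g (d x) + 0 - g (d x)\<close> by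
      \<open>dd\<close> and \<open>gd(2)\<close>.\<close>
    then show "?h x \<in> C' n"
      unfolding C'_def using gg[OF x] gdg[OF x] gd(1,2)[OF x] dd[OF x] dd[OF g_into[OF x]]
      by (simp add: linear_add[OF d] linear_add[OF g] linear_0[OF g])
    show "d (?h x) = ?h (d x)"
      using dd[OF x] dd[OF g_into[OF x]] linear_0[OF g]
      by (simp add: linear_add[OF d])
    show "?h x - x \<in> d ` C (Suc n)" if "d x = 0"
      using that g_into[OF x] linear_0[OF g] by auto
  next
    show "?h x = x" if "x \<in> C' n" for n x
      using that linear_0[OF d] unfolding C'_def by simp
  qed
qed


section \<open>The boundary operator on paths\<close>

lemma lookup_scaleR [simp]:
  "Poly_Mapping.lookup (c *\<^sub>R (x :: 'b \<Rightarrow>\<^sub>0 real)) p = c * Poly_Mapping.lookup x p"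
  by (simp add: scaleR_poly_mapping_def Abs_poly_mapping_inverse)

lemma lin_ext_sum:
  "lin_ext g (\<Sum>i\<in>I. c i *\<^sub>R elem (q i)) = (\<Sum>i\<in>I. c i *\<^sub>R g (q i))"
  using linear_lin_ext[of g] by (simp add: linear_sum linear_scale)

text \<open>Lifts identities between linear maps from elementary paths to all chains, and expands a
  boundary into its faces.\<close>

lemma lin_ext_eq_sum:
  assumes "linear h"
  shows "h x = (\<Sum>p\<in>Poly_Mapping.keys x. Poly_Mapping.lookup x p *\<^sub>R h (elem p))"
proof -
  have "x = (\<Sum>p\<in>Poly_Mapping.keys x. Poly_Mapping.lookup x p *\<^sub>R elem p)"
    by (rule poly_mapping_eqI)
      (auto simp: lookup_sum lookup_single when_def in_keys_iff if_distrib[of "(*) _"] cong: if_cong)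
  then have "h x = h (\<Sum>p\<in>Poly_Mapping.keys x. Poly_Mapping.lookup x p *\<^sub>R elem p)"
    by simp
  then show ?thesis
    by (simp only: linear_sum[OF assms] linear_scale[OF assms])
qed

lemma linear_path_boundary: "linear path_boundary"
  unfolding path_boundary_def by (rule linear_lin_ext)

lemma linear_grad: "linear (grad V E f)"
  unfolding grad_def by (rule linear_lin_ext)

lemmas linear_simps =
  linear_0[OF linear_path_boundary] linear_add[OF linear_path_boundary]
  linear_scale[OF linear_path_boundary]
  linear_0[OF linear_grad] linear_add[OF linear_grad] linear_scale[OF linear_grad]

lemma length_remove_nth: "i < length p \<Longrightarrow> length (remove_nth i p) = length p - 1"
  by (simp add: remove_nth_def)

lemma remove_nth_Cons_0 [simp]: "remove_nth 0 (a # p) = p"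
  by (simp add: remove_nth_def)

lemma remove_nth_Cons_Suc [simp]: "remove_nth (Suc i) (a # p) = a # remove_nth i p"
  by (simp add: remove_nth_def)

text \<open>Unlike \<^const>\<open>path_boundary\<close>, the augmented boundary maps 0-paths to the empty list. It satisfies
  the recursion \<open>\<partial>(a\<cdot>x) = x - a\<cdot>\<partial>x\<close>, which makes \<open>\<partial>\<partial> = 0\<close> an induction on lists.\<close>

definition augmented_boundary :: "'a chain \<Rightarrow> 'a chain" where
  "augmented_boundary = lin_ext (\<lambda>p. \<Sum>i<length p. (-1) ^ i *\<^sub>R elem (remove_nth i p))"

definition cons_chain :: "'a \<Rightarrow> 'a chain \<Rightarrow> 'a chain" where
  "cons_chain a = lin_ext (\<lambda>p. elem (a # p))"

text \<open>Removing \<open>a\<close> itself leaves \<open>x\<close>; removing a later vertex shifts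
  the index by one, whence the minus sign.\<close>

lemma augmented_boundary_cons_chain:
  "augmented_boundary (cons_chain a x) = x - cons_chain a (augmented_boundary x)"
proof -
  have lin: "linear (augmented_boundary :: 'a chain \<Rightarrow> _)" "linear (cons_chain a)"
    unfolding augmented_boundary_def cons_chain_def by (rule linear_lin_ext)+
  have base: "augmented_boundary (cons_chain a (elem p))
      = elem p - cons_chain a (augmented_boundary (elem p))" for p
    by (simp add: augmented_boundary_def cons_chain_def lin_ext_sum sum.lessThan_Suc_shift
        sum_negf del: sum.lessThan_Suc)
  have "linear (\<lambda>x. augmented_boundary (cons_chain a x))"
    "linear (\<lambda>x. x - cons_chain a (augmented_boundary x))"
    using lin by (auto intro!: linearI simp: linear_add linear_scale algebra_simps)
  from lin_ext_eq_sum[OF this(1), of x] lin_ext_eq_sum[OF this(2), of x] show ?thesis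
    by (simp only: base)
qed

text \<open>By the recursion, two applications to \<open>a # p\<close> give \<partial>p -
  (\<partial>p - a \<partial>\<partial>p), and the last term vanishes by induction.\<close>

lemma augmented_boundary_twice: "augmented_boundary (augmented_boundary (elem p)) = 0"
proof (induction p)
  case Nil
  show ?case
    by (simp add: augmented_boundary_def) (simp add: lin_ext_def)
next
  case (Cons a p)
  have "elem (a # p) = cons_chain a (elem p)"
    by (simp add: cons_chain_def)
  moreover have "linear (augmented_boundary :: 'a chain \<Rightarrow> _)" "linear (cons_chain a)"
    unfolding augmented_boundary_def cons_chain_def by (rule linear_lin_ext)+
  ultimately show ?case
    using Cons by (simp add: augmented_boundary_cons_chain linear_diff linear_0)
qed

lemma path_boundary_elem:
  "length p > 1 \<Longrightarrow>
    path_boundary (elem p) = (\<Sum>i<length p. (-1) ^ i *\<^sub>R elem (remove_nth i p))"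
  by (simp add: path_boundary_def)

lemma path_boundary_elem_short: "length p \<le> 1 \<Longrightarrow> path_boundary (elem p) = 0"
  by (simp add: path_boundary_def)

lemma path_boundary_twice: "path_boundary (path_boundary x) = 0"
proof -
  have base: "path_boundary (path_boundary (elem p)) = 0" for p :: "'a list"
  \<comment> \<open>The two boundary operators agree on lists of length at least 2. For length above
    2 this covers both applications; for length 2 the faces are 0-paths, which
    \<open>path_boundary\<close> sends to 0.\<close>
  proof (cases "length p \<le> 2")
    case True
    show ?thesis
    proof (cases "length p \<le> 1")
      case True
      then show ?thesis
        by (simp add: path_boundary_elem_short linear_simps)
    next
      case False
      with True have "length p = 2" by simp
      then show ?thesis
        by (simp add: path_boundary_elem linear_sum[OF linear_path_boundary]
            linear_simps path_boundary_elem_short length_remove_nth)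
    qed
  next
    case False
    then have "path_boundary (path_boundary (elem p))
        = augmented_boundary (augmented_boundary (elem p))"
      by (simp add: path_boundary_elem linear_sum[OF linear_path_boundary] length_remove_nth
          linear_simps augmented_boundary_def lin_ext_sum)
    then show ?thesis
      by (simp add: augmented_boundary_twice)
  qed
  have "linear (\<lambda>x :: 'a chain. path_boundary (path_boundary x))"
    by (intro linearI)
      (simp_all add: linear_simps)
  from lin_ext_eq_sum[OF this, of x] show ?thesis
    by (simp add: base)
qed

section \<open>The complex \<Omega>\<close>

text \<open>With \<open>T = {0}\<close> it reduces a linear identity on a span to the
  generators.\<close>

lemma linear_span_image_subset:
  assumes "linear h" "\<And>x. x \<in> S \<Longrightarrow> h x \<in> T" "subspace T" "x \<in> span S"
  shows "h x \<in> T"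
proof -
  have "h ` span S = span (h ` S)"
    using linear_span_image[OF assms(1)] by simp
  also have "\<dots> \<subseteq> T"
    using assms(2,3) by (intro span_minimal) auto
  finally show ?thesis
    using assms(4) by auto
qed

lemma chain_complex_Omega: "chain_complex (Omega V E) path_boundary"
proof -
  have "path_boundary x = 0" if "x \<in> Omega V E 0" for x
  proof -
    have "path_boundary x \<in> {0}"
      by (rule linear_span_image_subset[where S = "elem ` {p. allowed V E p \<and> length p = Suc 0}"])
        (use that in \<open>auto simp: linear_path_boundary path_boundary_elem_short Omega_def
            allowed_chains_def subspace_0\<close>)
    then show ?thesis by simp
  qed
  moreover have "subspace (Omega V E n)" for n
    unfolding Omega_def allowed_chains_def subspace_def
    by (auto simp: linear_simps span_0 span_add span_scale)
  moreover have "path_boundary x \<in> Omega V E n" if "x \<in> Omega V E (Suc n)" for x n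
    using that by (auto simp: Omega_def path_boundary_twice allowed_chains_def span_0)
  ultimately show ?thesis
    unfolding chain_complex_def
    by (simp add: linear_path_boundary path_boundary_twice)
qed


section \<open>Discrete Morse functions on transitive digraphs\<close>

locale transitive_morse =
  fixes V :: "'a set" and E :: "('a \<times> 'a) set" and f :: "'a \<Rightarrow> real"
  assumes digraph: "digraph V E" and trans: "trans E" and morse: "discrete_morse V E f"
begin

abbreviation grd :: "'a chain \<Rightarrow> 'a chain" where
  "grd \<equiv> grad V E f"

section \<open>Faces of allowed paths and zeros of the Morse function\<close>

text \<open>By transitivity the edge condition on neighbours extends to all pairs of positions, in
  which form it passes to sublists.\<close>

lemma allowed_iff: "allowed V E p \<longleftrightarrow> p \<noteq> [] \<and> set p \<subseteq> V \<and> sorted_wrt (\<lambda>u v. (u, v) \<in> E) p"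
  using trans unfolding allowed_def
  by (metis (no_types, lifting) successively_conv_sorted_wrt transD transpI)

text \<open>A repeated vertex would yield a loop.\<close>

lemma allowed_distinct: "allowed V E p \<Longrightarrow> distinct p"
proof -
  have "sorted_wrt (\<lambda>u v. (u, v) \<in> E) q \<Longrightarrow> distinct q" for q
    using digraph by (induction q) (auto simp: digraph_def)
  then show "allowed V E p \<Longrightarrow> distinct p"
    unfolding allowed_iff by blast
qed

lemma allowed_remove:
  "allowed V E (xs @ z # ys) \<Longrightarrow> xs @ ys \<noteq> [] \<Longrightarrow> allowed V E (xs @ ys)"
  unfolding allowed_iff by (auto simp: sorted_wrt_append)

lemma strict_subseq_remove: "strict_subseq (xs @ ys) (xs @ z # ys)"
  by (auto simp: strict_subseq_def intro: list_emb_append_mono)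

text \<open>In a list without repetitions \<open>z\<close> has one position, so a face other than
  \<open>xs @ ys\<close> omits a different vertex. Thus all other faces keep a given zero of
  \<open>f\<close>.\<close>

lemma remove_other:
  assumes "distinct (xs @ z # ys)" "xs @ z # ys = us @ w # vs" "us @ vs \<noteq> xs @ ys"
  shows "z \<in> set (us @ vs)"
proof (cases "w = z")
  case True
  have "us = xs \<and> vs = ys"
    using assms(1,2) unfolding True
    by (subst (asm) append_Cons_eq_iff) auto
  with assms(3) show ?thesis by simp
next
  case False
  have "z \<in> set (us @ w # vs)"
    by (simp flip: assms(2))
  with False show ?thesis by simp
qed

lemma equal_face_remove:
  assumes "allowed V E (xs @ z # ys)" "xs @ ys \<noteq> []" "f z = 0"
  shows "xs @ ys \<in> equal_faces V E f (xs @ z # ys)"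
  using assms allowed_remove[OF assms(1,2)]
  by (simp add: equal_faces_def path_value_def strict_subseq_remove)

text \<open>A second zero \<open>w\<close> would give a second face of equal value:
  \<open>us @ vs\<close> omits \<open>w\<close>, while \<open>xs @ ys\<close> contains it. This
  contradicts the Morse bound.\<close>

lemma zero_unique:
  assumes al: "allowed V E (xs @ z # ys)" and z: "f z = 0" and w: "w \<in> set (xs @ ys)"
  shows "f w \<noteq> 0"
proof
  assume w0: "f w = 0"
  let ?p = "xs @ z # ys"
  have ne: "xs @ ys \<noteq> []" using w by auto
  from w have "w \<in> set ?p" by auto
  then obtain us vs where uv: "?p = us @ w # vs"
    by (meson split_list)
  have dist: "distinct ?p"
    using al by (rule allowed_distinct)
  have "distinct (us @ w # vs)"
    using dist unfolding uv .
  then have "w \<notin> set (us @ vs)"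
    by simp
  with w have "us @ vs \<noteq> xs @ ys"
    by metis
  moreover have "us @ vs \<noteq> []"
    using ne arg_cong[OF uv, of length] by auto
  ultimately have ne': "us @ vs \<noteq> []" "us @ vs \<noteq> xs @ ys" by auto
  have "xs @ ys \<in> equal_faces V E f ?p"
    using equal_face_remove[OF al ne z] .
  moreover have "us @ vs \<in> equal_faces V E f ?p"
    using equal_face_remove[of us w vs] al ne' w0 uv by simp
  moreover have "finite (equal_faces V E f ?p)" "card (equal_faces V E f ?p) \<le> 1"
    using digraph morse al finite_equal_faces unfolding digraph_def discrete_morse_def by blast+
  ultimately show False
    using ne'(2) by (auto simp: card_le_Suc0_iff_eq)
qed

text \<open>Makes the face relation explicit as one removed vertex. If the first entries differ,
  \<open>p\<close> embeds in the tail, which has the same length, and so equals it.\<close>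

lemma subseq_remove_one:
  assumes "subseq p q" "length q = Suc (length p)"
  shows "\<exists>xs z ys. q = xs @ z # ys \<and> p = xs @ ys"
  using assms
proof (induction q arbitrary: p rule: list.induct)
  case (Cons y q)
  show ?case
  proof (cases p)
    case Nil
    with Cons.prems show ?thesis by simp
  next
    case (Cons x p')
    show ?thesis
    proof (cases "x = y")
      case True
      with Cons.prems Cons Cons.IH[of p'] obtain xs z ys where "q = xs @ z # ys" "p' = xs @ ys"
        by auto
      then have "y # q = (y # xs) @ z # ys" "p = (y # xs) @ ys"
        using Cons True by auto
      then show ?thesis by blast
    next
      case False
      with Cons.prems Cons have "p = q"
        by (simp add: subseq_same_length)
      then have "y # q = [] @ y # q" "p = [] @ q" by auto
      then show ?thesis by blast
    qed
  qed
qed simp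

section \<open>Cofaces of equal value and the gradient\<close>

lemma equal_cofacesE:
  assumes "\<gamma> \<in> equal_cofaces V E f \<alpha>"
  obtains xs z ys where "\<gamma> = xs @ z # ys" "\<alpha> = xs @ ys" "f z = 0" "allowed V E \<gamma>"
proof -
  from assms have a: "allowed V E \<gamma>" "length \<gamma> = Suc (length \<alpha>)" "subseq \<alpha> \<gamma>"
    "path_value f \<gamma> = path_value f \<alpha>"
    unfolding equal_cofaces_def strict_subseq_def by auto
  from subseq_remove_one[OF a(3,2)] obtain xs z ys where "\<gamma> = xs @ z # ys" "\<alpha> = xs @ ys"
    by blast
  moreover from this a(4) have "f z = 0"
    by (simp add: path_value_def)
  ultimately show ?thesis using a(1) that by blast
qed

lemma equal_cofaceI:
  assumes "allowed V E (xs @ z # ys)" "f z = 0"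
  shows "xs @ z # ys \<in> equal_cofaces V E f (xs @ ys)"
  using assms by (simp add: equal_cofaces_def path_value_def strict_subseq_remove)

text \<open>The vertex inserted in such a coface would be a second zero besides
  \<open>w\<close>.\<close>

lemma equal_cofaces_zero:
  assumes "w \<in> set \<alpha>" "f w = 0"
  shows "equal_cofaces V E f \<alpha> = {}"
proof (rule ccontr)
  assume "equal_cofaces V E f \<alpha> \<noteq> {}"
  then obtain \<gamma> where "\<gamma> \<in> equal_cofaces V E f \<alpha>" by blast
  then obtain xs z ys where "\<gamma> = xs @ z # ys" "\<alpha> = xs @ ys" "f z = 0" "allowed V E \<gamma>"
    by (rule equal_cofacesE)
  with zero_unique[of xs z ys w] assms show False by auto
qed

lemma grad_zero_vertex: "w \<in> set \<alpha> \<Longrightarrow> f w = 0 \<Longrightarrow> grd (elem \<alpha>) = 0"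
  using equal_cofaces_zero[of w \<alpha>] by (simp add: grad_def)

lemma equal_cofaces_unique:
  assumes "allowed V E \<alpha>" "\<gamma> \<in> equal_cofaces V E f \<alpha>"
  shows "equal_cofaces V E f \<alpha> = {\<gamma>}"
proof -
  have "finite (equal_cofaces V E f \<alpha>)" "card (equal_cofaces V E f \<alpha>) \<le> 1"
    using digraph morse assms finite_equal_cofaces unfolding digraph_def discrete_morse_def by blast+
  then show ?thesis
    using assms(2) by (auto simp: card_le_Suc0_iff_eq)
qed

lemma grad_coface:
  assumes "allowed V E \<alpha>" "\<gamma> \<in> equal_cofaces V E f \<alpha>"
  shows "grd (elem \<alpha>) = - Poly_Mapping.lookup (path_boundary (elem \<gamma>)) \<alpha> *\<^sub>R elem \<gamma>"
proof -
  have "chain_inner x (elem \<alpha>) = Poly_Mapping.lookup x \<alpha>" for x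
    unfolding chain_inner_def
    by (auto simp: lookup_single when_def in_keys_iff if_distrib[of "(*) _"] cong: if_cong)
  then show ?thesis
    using equal_cofaces_unique[OF assms] by (simp add: grad_def)
qed

section \<open>Boundary coefficients\<close>

lemma boundary_keys:
  assumes "\<beta> \<in> Poly_Mapping.keys (path_boundary (elem \<gamma>))"
  obtains xs z ys where "\<gamma> = xs @ z # ys" "\<beta> = xs @ ys" "\<beta> \<noteq> []"
proof -
  have len: "length \<gamma> > 1"
    using assms path_boundary_elem_short[of \<gamma>] by (cases "length \<gamma> \<le> 1") auto
  have "Poly_Mapping.lookup (path_boundary (elem \<gamma>)) \<beta> \<noteq> 0"
    using assms by (simp add: in_keys_iff)
  then obtain i where "i < length \<gamma>" "remove_nth i \<gamma> = \<beta>"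
    unfolding path_boundary_elem[OF len] lookup_sum
    by (auto simp: lookup_single when_def elim!: sum.not_neutral_contains_not_neutral split: if_splits)
  moreover from this len have "\<beta> \<noteq> []"
    using length_remove_nth[of i \<gamma>] by (cases \<beta>) simp_all
  ultimately show ?thesis
    using that[of "take i \<gamma>" "\<gamma> ! i" "drop (Suc i) \<gamma>"]
    by (auto simp: id_take_nth_drop[symmetric] remove_nth_def)
qed

text \<open>By distinctness \<open>z\<close> is the only vertex of the path missing from
  \<open>xs @ ys\<close>. Hence the face arises from a single index, and its coefficient in the
  boundary is one sign without cancellation.\<close>

lemma remove_nth_eq_iff:
  assumes "distinct (xs @ z # ys)" "i < length (xs @ z # ys)"
  shows "remove_nth i (xs @ z # ys) = xs @ ys \<longleftrightarrow> i = length xs"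
proof
  assume eq: "remove_nth i (xs @ z # ys) = xs @ ys"
  let ?p = "xs @ z # ys"
  have "?p = take i ?p @ ?p ! i # drop (Suc i) ?p"
    using assms(2) by (rule id_take_nth_drop)
  then have "set ?p = insert (?p ! i) (set (remove_nth i ?p))"
    unfolding remove_nth_def by (metis list.set(2) set_append Un_insert_right)
  then have "z = ?p ! i"
    using assms(1) eq by auto
  moreover have "z = ?p ! length xs" by simp
  ultimately show "i = length xs"
    using assms nth_eq_iff_index_eq[OF assms(1), of i "length xs"] by simp
qed (simp add: remove_nth_def)

lemma lookup_boundary_face:
  assumes "distinct (xs @ z # ys)" "xs @ ys \<noteq> []"
  shows "Poly_Mapping.lookup (path_boundary (elem (xs @ z # ys))) (xs @ ys) = (-1) ^ length xs"
proof -
  define p where "p = xs @ z # ys"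
  have k: "length xs < length p" "length p > 1"
    using assms(2) by (cases xs; cases ys; simp add: p_def)+
  have "Poly_Mapping.lookup (path_boundary (elem p)) (xs @ ys)
      = (\<Sum>i<length p. (-1) ^ i * Poly_Mapping.lookup (elem (remove_nth i p)) (xs @ ys))"
    by (simp only: path_boundary_elem[OF k(2)] lookup_sum lookup_scaleR)
  also have "\<dots> = (\<Sum>i<length p. if i = length xs then (-1) ^ i else 0)"
  proof (rule sum.cong[OF refl])
    fix i assume "i \<in> {..<length p}"
    then have "remove_nth i p = xs @ ys \<longleftrightarrow> i = length xs"
      using remove_nth_eq_iff[OF assms(1), of i] by (simp add: p_def)
    then show "(-1) ^ i * Poly_Mapping.lookup (elem (remove_nth i p)) (xs @ ys)
        = (if i = length xs then (-1) ^ i else 0)"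
      by (simp add: lookup_single when_def)
  qed
  also have "\<dots> = (-1) ^ length xs"
    using k(1) by (simp add: sum.delta)
  finally show ?thesis
    by (simp only: p_def)
qed

text \<open>All faces but \<open>xs @ ys\<close> contain \<open>z\<close> and are killed by the
  gradient. The remaining face returns the path itself, with its incidence sign squared and a
  minus.\<close>

lemma grad_boundary_zero_vertex:
  assumes al: "allowed V E (xs @ z # ys)" and ne: "xs @ ys \<noteq> []" and z: "f z = 0"
  shows "grd (path_boundary (elem (xs @ z # ys))) = - elem (xs @ z # ys)"
proof -
  let ?p = "xs @ z # ys" and ?q = "xs @ ys"
  let ?l = "Poly_Mapping.lookup (path_boundary (elem ?p))"
  have l: "?l ?q = (-1) ^ length xs"
    by (rule lookup_boundary_face[OF allowed_distinct[OF al] ne])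
  have other: "grd (elem b) = 0"
    if "b \<in> Poly_Mapping.keys (path_boundary (elem ?p)) - {?q}" for b
  proof -
    from that have "b \<in> Poly_Mapping.keys (path_boundary (elem ?p))" by blast
    then obtain us w vs where b: "?p = us @ w # vs" "b = us @ vs"
      by (rule boundary_keys)
    then have "z \<in> set b"
      using remove_other[OF allowed_distinct[OF al] b(1)] that by blast
    then show ?thesis
      using grad_zero_vertex z by blast
  qed
  have "grd (path_boundary (elem ?p))
      = (\<Sum>b\<in>Poly_Mapping.keys (path_boundary (elem ?p)). ?l b *\<^sub>R grd (elem b))"
    by (rule lin_ext_eq_sum[OF linear_grad])
  also have "\<dots> = ?l ?q *\<^sub>R grd (elem ?q)
      + (\<Sum>b\<in>Poly_Mapping.keys (path_boundary (elem ?p)) - {?q}. ?l b *\<^sub>R grd (elem b))"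
    by (rule sum.remove) (simp_all add: in_keys_iff l)
  also have "\<dots> = ?l ?q *\<^sub>R grd (elem ?q)"
    using other by simp
  also have "\<dots> = - elem ?p"
    unfolding grad_coface[OF allowed_remove[OF al ne] equal_cofaceI[OF al z]] l
    by simp
  finally show ?thesis .
qed

section \<open>Identities for the gradient\<close>

text \<open>All degrees are taken together, since the identities for \<open>grd\<close> do not
  depend on the degree.\<close>

abbreviation chains :: "'a chain set" where
  "chains \<equiv> span (elem ` {p. allowed V E p})"

lemma boundary_elem_chains:
  assumes "allowed V E p"
  shows "path_boundary (elem p) \<in> chains"
\<comment> \<open>Instantiated with the identity map, the expansion writes the boundary as a
  combination of its faces.\<close>
proof (subst lin_ext_eq_sum[OF linear_ident, of "path_boundary (elem p)"],
    intro span_sum span_scale span_base imageI CollectI)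
  fix q assume "q \<in> Poly_Mapping.keys (path_boundary (elem p))"
  then obtain xs z ys where "p = xs @ z # ys" "q = xs @ ys" "q \<noteq> []"
    by (rule boundary_keys)
  then show "allowed V E q"
    using allowed_remove assms by blast
qed

text \<open>The coefficient \<open>c\<close> stays unspecified: the identities below only use that
  the gradient is a multiple of a path through a zero of \<open>f\<close>.\<close>

lemma grad_elem_cases:
  assumes "allowed V E p"
  obtains "grd (elem p) = 0" | xs z ys c where "p = xs @ ys" "xs @ ys \<noteq> []" "f z = 0"
    "allowed V E (xs @ z # ys)" "grd (elem p) = c *\<^sub>R elem (xs @ z # ys)"
proof (cases "equal_cofaces V E f p = {}")
  case True
  then show ?thesis
    by (intro that(1)) (simp add: grad_def)
next
  case False
  then obtain q where q: "q \<in> equal_cofaces V E f p" by blast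
  then obtain xs z ys where "q = xs @ z # ys" "p = xs @ ys" "f z = 0" "allowed V E q"
    by (rule equal_cofacesE)
  moreover have "p \<noteq> []" using assms by (simp add: allowed_def)
  ultimately show ?thesis
    using that(2)[of xs ys z] grad_coface[OF assms q] by blast
qed

text \<open>The gradient yields multiples of paths through a zero, and those have gradient
  0.\<close>

lemma grad_grad:
  assumes "x \<in> chains"
  shows "grd (grd x) = 0"
proof -
  have "grd (grd (elem p)) = 0" if "allowed V E p" for p
    using that
  proof (cases rule: grad_elem_cases)
    case 1
    then show ?thesis by (simp add: linear_simps)
  next
    case (2 xs z ys c)
    then show ?thesis
      using grad_zero_vertex[of z] by (simp add: linear_simps)
  qed
  moreover have "linear (\<lambda>x. grd (grd x))"
    by (intro linearI) (simp_all add: linear_simps)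
  ultimately have "grd (grd x) \<in> {0}"
    using assms by (elim linear_span_image_subset[rotated 3]) auto
  then show ?thesis by simp
qed

text \<open>On the paths that the gradient yields, \<open>grad_boundary_zero_vertex\<close>
  applies.\<close>

lemma grad_boundary_grad:
  assumes "x \<in> chains"
  shows "grd (path_boundary (grd x)) = - grd x"
proof -
  have "grd (path_boundary (grd (elem p))) + grd (elem p) = 0" if "allowed V E p" for p
    using that
  proof (cases rule: grad_elem_cases)
    case 1
    then show ?thesis by (simp add: linear_simps)
  next
    case (2 xs z ys c)
    then show ?thesis
      using grad_boundary_zero_vertex[of xs z ys]
      by (simp add: linear_simps)
  qed
  moreover have "linear (\<lambda>x. grd (path_boundary (grd x)) + grd x)"
    by (intro linearI) (simp_all add: linear_simps algebra_simps)
  ultimately have "grd (path_boundary (grd x)) + grd x \<in> {0}"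
    using assms by (elim linear_span_image_subset[rotated 3]) auto
  then show ?thesis by (simp add: eq_neg_iff_add_eq_0)
qed

section \<open>Critical chains and the gradient flow\<close>

lemma critical_iff:
  "critical V E f p \<longleftrightarrow> allowed V E p \<and> equal_cofaces V E f p = {} \<and> equal_faces V E f p = {}"
  using digraph by (simp add: critical_def digraph_def finite_equal_cofaces finite_equal_faces)

lemma critical_chains_kernel:
  assumes "x \<in> critical_chains V E f n"
  shows "grd x = 0" and "grd (path_boundary x) = 0"
proof -
  have crit: "grd (elem a) = 0" "path_boundary (elem a) \<in> chains" if "critical V E f a" for a
    using that boundary_elem_chains by (auto simp: critical_iff grad_def)
  have "subspace {x. grd x = 0 \<and> grd (path_boundary x) = 0}"
    unfolding subspace_def by (simp add: linear_simps)
  \<comment> \<open>The first condition is \<open>grd (elem a) = 0\<close> with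
    \<open>grad_grad\<close>. In the second, \<open>grad_boundary_grad\<close> turns the correction
    term into minus the contribution of \<open>elem a\<close>.\<close>
  moreover have "elem a + grd (path_boundary (elem a)) \<in> {x. grd x = 0 \<and> grd (path_boundary x) = 0}"
    if "critical V E f a" for a
    using crit[OF that] grad_grad[OF crit(2)[OF that]] grad_boundary_grad[OF crit(2)[OF that]]
    by (simp add: linear_simps)
  ultimately have "critical_chains V E f n \<subseteq> {x. grd x = 0 \<and> grd (path_boundary x) = 0}"
    unfolding critical_chains_def by (intro span_minimal) auto
  with assms show "grd x = 0" "grd (path_boundary x) = 0" by auto
qed

text \<open>Forman's discrete gradient flow, the map \<Phi> of the outline; the retraction in
  \<open>homology_isomorphic_gradient\<close> has the same formula.\<close>

definition flow :: "'a chain \<Rightarrow> 'a chain" where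
  "flow x = x + path_boundary (grd x) + grd (path_boundary x)"

lemma linear_flow: "linear flow"
  unfolding flow_def by (intro linearI) (simp_all add: linear_simps algebra_simps)

lemma subspace_critical_chains: "subspace (critical_chains V E f n)"
  unfolding critical_chains_def by simp

lemma flow_critical:
  assumes "critical V E f p" "length p = Suc n"
  shows "flow (elem p) \<in> critical_chains V E f n"
proof -
  have "grd (elem p) = 0"
    using assms by (simp add: critical_iff grad_def)
  then have "flow (elem p) = elem p + grd (path_boundary (elem p))"
    by (simp add: flow_def linear_simps)
  then show ?thesis
    using assms unfolding critical_chains_def by (auto intro!: span_base)
qed

text \<open>The path has gradient 0, and the gradient of its boundary cancels the path. The 0-path
  at a zero of \<open>f\<close> is excluded: it has no faces and is critical.\<close>

lemma flow_zero_vertex: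
  assumes "allowed V E (xs @ z # ys)" "xs @ ys \<noteq> []" "f z = 0"
  shows "flow (elem (xs @ z # ys)) = 0"
  using grad_zero_vertex[of z "xs @ z # ys"] grad_boundary_zero_vertex[OF assms] assms(3)
  by (simp add: flow_def linear_simps)

lemma equal_facesE:
  assumes "\<beta> \<in> equal_faces V E f \<alpha>"
  obtains xs z ys where "\<alpha> = xs @ z # ys" "\<beta> = xs @ ys" "f z = 0" "\<beta> \<noteq> []"
proof -
  from assms have a: "allowed V E \<beta>" "length \<alpha> = Suc (length \<beta>)" "subseq \<beta> \<alpha>"
    "path_value f \<beta> = path_value f \<alpha>"
    unfolding equal_faces_def strict_subseq_def by auto
  from subseq_remove_one[OF a(3,2)] obtain xs z ys where "\<alpha> = xs @ z # ys" "\<beta> = xs @ ys"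
    by blast
  moreover from this a(4) have "f z = 0"
    by (simp add: path_value_def)
  ultimately show ?thesis using a(1) that by (auto simp: allowed_def)
qed

text \<open>Such a path is either critical, or has a face of equal value and so a zero of
  \<open>f\<close>, in which case the flow kills it.\<close>

lemma flow_no_coface:
  assumes "allowed V E p" "equal_cofaces V E f p = {}" "length p = Suc n"
  shows "flow (elem p) \<in> critical_chains V E f n"
proof (cases "equal_faces V E f p = {}")
  case True
  with assms show ?thesis
    by (intro flow_critical) (simp_all add: critical_iff)
next
  case False
  then obtain b where "b \<in> equal_faces V E f p" by blast
  then obtain xs z ys where "p = xs @ z # ys" "b = xs @ ys" "f z = 0" "b \<noteq> []"
    by (rule equal_facesE)
  then show ?thesis
    using flow_zero_vertex assms subspace_0[OF subspace_critical_chains] by simp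
qed

text \<open>If \<open>p\<close> has the coface \<open>q\<close> of equal value, then \<open>\<Phi>(\<partial>q) = \<partial>\<Phi>(q) = 0\<close> expresses \<open>\<Phi>(p)\<close> by the
  values of \<open>\<Phi>\<close> at the other faces of \<open>q\<close>, which contain a zero of \<open>f\<close> and so have no such coface.\<close>

lemma flow_elem:
  assumes al: "allowed V E p" and len: "length p = Suc n"
  shows "flow (elem p) \<in> critical_chains V E f n"
proof (cases "equal_cofaces V E f p = {}")
  case True
  with assms show ?thesis by (intro flow_no_coface)
next
  case False
  then obtain q where "q \<in> equal_cofaces V E f p" by blast
  then obtain xs z ys where "q = xs @ z # ys" and q: "p = xs @ ys" "f z = 0" "allowed V E q"
    by (rule equal_cofacesE)
  with q have q: "p = xs @ ys" "f z = 0" "allowed V E (xs @ z # ys)" by auto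
  have ne: "xs @ ys \<noteq> []" using q(1) al by (simp add: allowed_def)
  let ?q = "xs @ z # ys"
  let ?K = "Poly_Mapping.keys (path_boundary (elem ?q))"
  let ?l = "Poly_Mapping.lookup (path_boundary (elem ?q))"
  have l: "?l p = (-1) ^ length xs"
    unfolding q(1) by (rule lookup_boundary_face[OF allowed_distinct[OF q(3)] ne])
  have pK: "p \<in> ?K"
    using l by (simp add: in_keys_iff)
  have other: "flow (elem b) \<in> critical_chains V E f n" if "b \<in> ?K - {p}" for b
  proof -
    from that have "b \<in> ?K" by blast
    then obtain us w vs where b: "?q = us @ w # vs" "b = us @ vs" "b \<noteq> []"
      by (rule boundary_keys)
    then have "z \<in> set b"
      using remove_other[OF allowed_distinct[OF q(3)] b(1)] that q(1) by blast
    then have "equal_cofaces V E f b = {}"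
      using equal_cofaces_zero q(2) by blast
    moreover have "allowed V E b"
      using b allowed_remove[of us w vs] q(3) by simp
    moreover have "length b = Suc n"
      using arg_cong[OF b(1), of length] len unfolding b(2) q(1) by simp
    ultimately show ?thesis
      by (intro flow_no_coface)
  qed
  have "grd (elem ?q) = 0"
    using grad_zero_vertex[of z ?q] q(2) by simp
  then have "flow (path_boundary (elem ?q)) = path_boundary (flow (elem ?q))"
    by (simp add: flow_def linear_simps path_boundary_twice)
  also have "\<dots> = 0"
    by (simp add: flow_zero_vertex[OF q(3) ne q(2)] linear_simps)
  finally have "(\<Sum>b\<in>?K. ?l b *\<^sub>R flow (elem b)) = 0"
    using lin_ext_eq_sum[OF linear_flow, of "path_boundary (elem ?q)"] by simp
  then have "?l p *\<^sub>R flow (elem p) = - (\<Sum>b\<in>?K - {p}. ?l b *\<^sub>R flow (elem b))"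
    using pK by (simp add: sum.remove eq_neg_iff_add_eq_0)
  also have "\<dots> \<in> critical_chains V E f n"
    using other subspace_critical_chains
    by (intro subspace_neg subspace_sum subspace_scale) auto
  \<comment> \<open>\<open>?l p\<close> is a sign, so multiplying by it once more isolates
    \<open>flow (elem p)\<close>.\<close>
  finally have "?l p *\<^sub>R ?l p *\<^sub>R flow (elem p) \<in> critical_chains V E f n"
    by (rule subspace_scale[OF subspace_critical_chains])
  then show ?thesis
    using l by simp
qed

lemma flow_in_critical_chains:
  "x \<in> allowed_chains V E n \<Longrightarrow> flow x \<in> critical_chains V E f n"
  unfolding allowed_chains_def using linear_flow subspace_critical_chains flow_elem
  by (elim linear_span_image_subset[rotated 3]) auto

text \<open>A chain satisfying both kernel conditions is fixed by the flow, whose values on allowed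
  chains are critical chains.\<close>

lemma mem_critical_chains_iff:
  assumes "x \<in> allowed_chains V E n"
  shows "x \<in> critical_chains V E f n \<longleftrightarrow> grd x = 0 \<and> grd (path_boundary x) = 0"
proof
  assume "grd x = 0 \<and> grd (path_boundary x) = 0"
  then have "flow x = x"
    by (simp add: flow_def linear_simps)
  then show "x \<in> critical_chains V E f n"
    using flow_in_critical_chains[OF assms] by simp
qed (use critical_chains_kernel in blast)

end


section \<open>Path homology of the digraph\<close>

theorem theorem4p8:
  fixes V :: "'a set" and E Ebar :: "('a \<times> 'a) set" and f fbar :: "'a \<Rightarrow> real"
  assumes "digraph V E"
    and "transitive_closure_of V E Ebar"
    and "discrete_morse V E f"
    and "\<forall>v\<in>V. fbar v = f v"
    and "discrete_morse V Ebar fbar"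
    and "\<forall>n. grad V Ebar fbar ` Omega V E n \<subseteq> Omega V E (Suc n)"
  shows "chain_complex (\<lambda>n. critical_chains V Ebar fbar n \<inter> Omega V E n) path_boundary \<and>
    (\<forall>m. homology_isomorphic (Omega V E) path_boundary
           (\<lambda>n. critical_chains V Ebar fbar n \<inter> Omega V E n) path_boundary m)"
proof -
  interpret transitive_morse V Ebar fbar
    using assms(2,5) by unfold_locales (auto simp: transitive_closure_of_def)
  have "allowed V Ebar p" if "allowed V E p" for p
    using that assms(2) unfolding allowed_def transitive_closure_of_def
    by (auto elim: successively_mono)
  then have mono: "Omega V E n \<subseteq> allowed_chains V Ebar n" for n
    unfolding Omega_def allowed_chains_def
    using span_mono[of "elem ` {p. allowed V E p \<and> length p = Suc n}"
        "elem ` {p. allowed V Ebar p \<and> length p = Suc n}"] by auto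
  have "allowed_chains V Ebar n \<subseteq> chains" for n
    unfolding allowed_chains_def by (intro span_mono) auto
  with mono have Omega_chains: "x \<in> chains" if "x \<in> Omega V E n" for x n
    using that by blast
  let ?A = "\<lambda>n. critical_chains V Ebar fbar n \<inter> Omega V E n"
  \<comment> \<open>Inside \<open>Omega\<close>, membership in A_n becomes the kernel condition that
    cuts out the subcomplex in \<open>homology_isomorphic_gradient\<close>.\<close>
  have eq: "?A = (\<lambda>n. {x \<in> Omega V E n. grd x = 0 \<and> grd (path_boundary x) = 0})"
    using mem_critical_chains_iff mono by (intro ext) (auto dest: subsetD)
  have into: "grd x \<in> Omega V E (Suc n)" if "x \<in> Omega V E n" for x n
    using that assms(6) by blast
  have core: "chain_complex ?A path_boundary \<and>
      homology_isomorphic (Omega V E) path_boundary ?A path_boundary m" for m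
    unfolding eq
    by (rule homology_isomorphic_gradient)
      (fact chain_complex_Omega linear_grad into grad_grad[OF Omega_chains]
        grad_boundary_grad[OF Omega_chains])+
  show ?thesis
    by (intro conjI allI conjunct1[OF core] conjunct2[OF core])
qed

end
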